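(* Let $\Gamma_0,\Gamma_1,\Gamma_2,\Gamma_3$ be Hermitian $4\times 4$ complex matrices with $\Gamma_j^2=\mathbb{I}$ and $\Gamma_j\Gamma_k=-\Gamma_k\Gamma_j$ for $j\ne k$, and let $\Gamma_4=\Gamma_0\Gamma_1\Gamma_2\Gamma_3$. Let $\mathcal{B}_0,\mathcal{B}_1,\mathcal{B}_2,\mathcal{B}_3$ be the common orthonormal eigenbases of the four classes of commuting operators $$\mathcal{C}_{0} = \{\Gamma_{0}, i\Gamma_{1}\Gamma_{4}, i\Gamma_{2}\Gamma_{3} \},\quad \mathcal{C}_{1} = \{\Gamma_{1}, i\Gamma_{2}\Gamma_{4}, i\Gamma_{3}\Gamma_{0} \},$$ $$\mathcal{C}_{2} = \{\Gamma_{2}, i\Gamma_{3}\Gamma_{4}, i\Gamma_{0}\Gamma_{1} \},\quad \mathcal{C}_{3} = \{\Gamma_{3}, i\Gamma_{0}\Gamma_{4}, i\Gamma_{1}\Gamma_{2} \},$$ and let $U$ be a unitary with $U\Gamma_jU^\dagger=\Gamma_{(j+1)\bmod 4}$ for $j=0,1,2,3$. Then for every unit vector $|\psi\rangle\in\mathbb{C}^4$ $$\frac{1}{4}\sum_{j=0}^{3}H_{\infty}(\mathcal{B}_{j}\,|\,|\psi\rangle) \geq -\log\left[\frac{1}{4}\left(1 + \frac{3}{2}\right)\right],$$ and this bound is tight: equality is attained by a unit vector $|\psi\rangle$ that is an eigenvector of $U$.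
   Context: For an orthonormal basis $\mathcal{B}=\{|b\rangle\}_b$ and a unit vector $|\psi\rangle$, the min-entropy is $H_\infty(\mathcal{B}\,|\,|\psi\rangle) = -\log \max_{b} |\langle b|\psi\rangle|^2$. Logarithms are base 2. The common eigenbasis of each class is unique up to phases and ordering of its elements. Two orthonormal bases of $\mathbb{C}^4$ are mutually unbiased if $|\langle a|b\rangle|=1/2$ for all elements $|a\rangle$ of the first and $|b\rangle$ of the second; the four bases in the claim are mutually unbiased, and $U$ cyclically permutes them (up to phases of the basis vectors). *)

theory Defs
  imports "HOL-Analysis.Analysis"
begin

definition cinner_vec :: "complex ^ 'n \<Rightarrow> complex ^ 'n \<Rightarrow> complex" where
  "cinner_vec x y = (\<Sum>i\<in>UNIV. cnj (x $ i) * y $ i)"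

definition adjoint_mat :: "complex ^ 'n ^ 'm \<Rightarrow> complex ^ 'm ^ 'n" where
  "adjoint_mat A = (\<chi> i j. cnj (A $ j $ i))"

definition hermitian_mat :: "complex ^ 'n ^ 'n \<Rightarrow> bool" where
  "hermitian_mat A \<longleftrightarrow> adjoint_mat A = A"

definition unitary_mat :: "complex ^ 'n ^ 'n \<Rightarrow> bool" where
  "unitary_mat A \<longleftrightarrow> adjoint_mat A ** A = mat 1 \<and> A ** adjoint_mat A = mat 1"

definition scale_mat :: "complex \<Rightarrow> complex ^ 'n ^ 'm \<Rightarrow> complex ^ 'n ^ 'm" (infixr "\<cdot>\<^sub>m" 69) where
  "c \<cdot>\<^sub>m A = (\<chi> i j. c * A $ i $ j)"

definition eigenvector_of :: "complex ^ 'n ^ 'n \<Rightarrow> complex ^ 'n \<Rightarrow> bool" where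
  "eigenvector_of A v \<longleftrightarrow> v \<noteq> 0 \<and> (\<exists>c. A *v v = c *s v)"

(* A basis of the n-dimensional space is a family indexed by the n-element type 'n itself. *)
definition orthonormal_basis :: "('n \<Rightarrow> complex ^ 'n) \<Rightarrow> bool" where
  "orthonormal_basis B \<longleftrightarrow>
     (\<forall>a b. cinner_vec (B a) (B b) = (if a = b then 1 else 0)) \<and> vec.span (range B) = UNIV"

definition common_eigenbasis :: "(complex ^ 'n ^ 'n) set \<Rightarrow> ('n \<Rightarrow> complex ^ 'n) \<Rightarrow> bool" where
  "common_eigenbasis C B \<longleftrightarrow> orthonormal_basis B \<and> (\<forall>A\<in>C. \<forall>b. eigenvector_of A (B b))"

definition min_entropy :: "('n \<Rightarrow> complex ^ 'n) \<Rightarrow> complex ^ 'n \<Rightarrow> real" where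
  "min_entropy B \<psi> = - log 2 (Max (range (\<lambda>b. (cmod (cinner_vec (B b) \<psi>))\<^sup>2)))"

end

theory Submission
  imports Defs
begin

text \<open>The three operators of a class generate a stabilizer group, so the rank one projector on a
  basis vector is a quarter of the identity plus the operators with signs. Every operator of one
  class anticommutes with some operator of any other, hence has mean zero in the other basis: the
  bases are mutually unbiased. A Gram matrix estimate bounds the sum of the four maximal outcome
  probabilities by \<open>1 + 3/2\<close>, and concavity of the logarithm gives the inequality.

  For equality, take the four rank one projectors \<open>P\<^sub>j\<close> with signs chosen so that \<open>U\<close> permutes
  them cyclically. They satisfy \<open>P\<^sub>l P\<^sub>j P\<^sub>0 = P\<^sub>l P\<^sub>0 / 2\<close> for distinct \<open>j, l\<close> in \<open>{1, 2, 3}\<close>.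
  If \<open>e\<close> spans the range of \<open>P\<^sub>0\<close>, then \<open>e + 2 (P\<^sub>1 + P\<^sub>2 + P\<^sub>3) e\<close> attains the Gram bound and
  is an eigenvector of \<open>U\<close>.\<close>

section \<open>The complex inner product\<close>

lemma cinner_vec_add_right: "cinner_vec x (y + z) = cinner_vec x y + cinner_vec x z"
  by (simp add: cinner_vec_def algebra_simps sum.distrib)

lemma cinner_vec_add_left: "cinner_vec (x + y) z = cinner_vec x z + cinner_vec y z"
  by (simp add: cinner_vec_def algebra_simps sum.distrib)

lemma cinner_vec_scale_right: "cinner_vec x (c *s y) = c * cinner_vec x y"
  by (simp add: cinner_vec_def algebra_simps sum_distrib_left)

lemma cinner_vec_scale_left: "cinner_vec (c *s x) y = cnj c * cinner_vec x y"
  by (simp add: cinner_vec_def algebra_simps sum_distrib_left)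

lemma cinner_vec_minus_right: "cinner_vec x (- y) = - cinner_vec x y"
  by (simp add: cinner_vec_def sum_negf)

lemma cinner_vec_minus_left: "cinner_vec (- x) y = - cinner_vec x y"
  by (simp add: cinner_vec_def sum_negf)

lemma cinner_vec_zero_right: "cinner_vec x 0 = 0"
  by (simp add: cinner_vec_def)

lemma cinner_vec_zero_left: "cinner_vec 0 x = 0"
  by (simp add: cinner_vec_def)

lemma cinner_vec_sum_right: "cinner_vec x (\<Sum>j\<in>J. f j) = (\<Sum>j\<in>J. cinner_vec x (f j))"
  by (induction J rule: infinite_finite_induct)
    (simp_all add: cinner_vec_zero_right cinner_vec_add_right)

lemma cinner_vec_sum_left: "cinner_vec (\<Sum>j\<in>J. f j) x = (\<Sum>j\<in>J. cinner_vec (f j) x)"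
  by (induction J rule: infinite_finite_induct)
    (simp_all add: cinner_vec_zero_left cinner_vec_add_left)

lemmas cinner_vec_linear = cinner_vec_add_left cinner_vec_add_right cinner_vec_scale_left
  cinner_vec_scale_right cinner_vec_minus_left cinner_vec_minus_right
  cinner_vec_sum_left cinner_vec_sum_right

lemma cnj_cinner_vec: "cnj (cinner_vec x y) = cinner_vec y x"
  by (simp add: cinner_vec_def mult.commute)

lemma cinner_vec_mult_swap: "cinner_vec x y * cinner_vec y x = of_real ((cmod (cinner_vec x y))\<^sup>2)"
  by (metis cnj_cinner_vec complex_norm_square)

lemma cnj_mult_self: "cnj z * z = (complex_of_real (cmod z))\<^sup>2"
  by (metis complex_norm_square mult.commute of_real_power)

lemma cinner_vec_self: "cinner_vec x x = of_real ((norm x)\<^sup>2)"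
proof -
  have "cinner_vec x x = (\<Sum>i\<in>UNIV. of_real ((cmod (x $ i))\<^sup>2))"
    unfolding cinner_vec_def
    by (intro sum.cong refl) (metis complex_norm_square mult.commute)
  also have "\<dots> = of_real ((norm x)\<^sup>2)"
    by (simp add: norm_vec_def L2_set_def sum_nonneg)
  finally show ?thesis .
qed

lemma cinner_vec_adjoint: "cinner_vec (adjoint_mat A *v x) y = cinner_vec x (A *v y)"
  unfolding cinner_vec_def adjoint_mat_def matrix_vector_mult_def
  by (simp add: sum_distrib_left sum_distrib_right, subst sum.swap) (simp add: mult_ac)

lemma cinner_vec_hermitian:
  "hermitian_mat A \<Longrightarrow> cinner_vec (A *v x) y = cinner_vec x (A *v y)"
  by (metis cinner_vec_adjoint hermitian_mat_def)

text \<open>The difference of the images of \<open>x\<close> under \<open>adjoint_mat A\<close> and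
  \<open>A\<close> is orthogonal to every vector, so in particular to itself.\<close>

lemma hermitianI_cinner:
  assumes "\<And>x y. cinner_vec (A *v x) y = cinner_vec x (A *v y)"
  shows "hermitian_mat A"
proof -
  have "cinner_vec (adjoint_mat A *v x - A *v x) y = 0" for x y
    using assms[of x y] cinner_vec_adjoint[of A x y]
    by (simp only: diff_conv_add_uminus cinner_vec_linear) simp
  then have "cinner_vec (adjoint_mat A *v x - A *v x) (adjoint_mat A *v x - A *v x) = 0" for x
    by blast
  then show ?thesis
    by (simp add: cinner_vec_self hermitian_mat_def matrix_eq)
qed

section \<open>Linearity of the matrix action on vectors\<close>

lemma scale_mat_vector_mult: "(c \<cdot>\<^sub>m A) *v x = c *s (A *v x)"
  by (simp add: scale_mat_def matrix_vector_mult_def vec_eq_iff sum_distrib_left mult_ac)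

lemma matrix_vector_mult_neg: "A *v (- x) = - (A *v (x :: 'a::comm_ring_1 ^ 'n))"
  by (simp add: matrix_vector_mult_def vec_eq_iff sum_negf)

lemma neg_matrix_vector_mult: "(- A) *v x = - (A *v (x :: 'a::comm_ring_1 ^ 'n))"
  by (simp add: matrix_vector_mult_def vec_eq_iff sum_negf)

lemma matrix_vector_mult_scale: "A *v (c *s x) = c *s (A *v (x :: 'a::comm_ring_1 ^ 'n))"
  by (simp add: matrix_vector_mult_def vec_eq_iff sum_distrib_left mult_ac)

lemma matrix_vector_mult_sum: "A *v (\<Sum>j\<in>J. f j) = (\<Sum>j\<in>J. A *v (f j :: 'a::comm_ring_1 ^ 'n))"
  by (induction J rule: infinite_finite_induct)
    (simp_all add: matrix_vector_right_distrib)

section \<open>Orthonormal bases\<close>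

lemma orthonormal_cinner:
  "orthonormal_basis B \<Longrightarrow> cinner_vec (B a) (B b) = (if a = b then 1 else 0)"
  by (simp add: orthonormal_basis_def)

text \<open>The columns of \<open>V\<close> are the basis vectors, so orthonormality is the first
  equation. For a square matrix a left inverse is also a right inverse, and the second equation is
  the completeness relation.\<close>

lemma orthonormal_matrix:
  fixes B :: "'n \<Rightarrow> complex ^ 'n"
  assumes "orthonormal_basis B"
  defines "V \<equiv> (\<chi> i j. B j $ i)"
  shows "adjoint_mat V ** V = mat 1" "V ** adjoint_mat V = mat 1"
proof -
  show "adjoint_mat V ** V = mat 1"
    using orthonormal_cinner[OF assms(1)]
    by (simp add: V_def adjoint_mat_def matrix_matrix_mult_def mat_def cinner_vec_def vec_eq_iff)
  then show "V ** adjoint_mat V = mat 1"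
    by (simp add: matrix_left_right_inverse)
qed

lemma orthonormal_expansion:
  assumes "orthonormal_basis B"
  shows "(\<Sum>b\<in>UNIV. cinner_vec (B b) x *s B b) = x"
proof -
  let ?V = "\<chi> i j. B j $ i"
  have "(\<Sum>b\<in>UNIV. cinner_vec (B b) x *s B b) = ?V *v (adjoint_mat ?V *v x)"
    by (simp add: vec_eq_iff matrix_vector_mult_def adjoint_mat_def cinner_vec_def mult.commute)
  then show ?thesis
    using orthonormal_matrix(2)[OF assms] by (simp add: matrix_vector_mul_assoc)
qed

lemma parseval:
  assumes "orthonormal_basis B"
  shows "(\<Sum>b\<in>UNIV. (cmod (cinner_vec (B b) x))\<^sup>2) = (norm x)\<^sup>2"
proof -
  have "of_real ((norm x)\<^sup>2) = cinner_vec (\<Sum>b\<in>UNIV. cinner_vec (B b) x *s B b) x"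
    by (simp add: orthonormal_expansion[OF assms] cinner_vec_self)
  also have "\<dots> = of_real (\<Sum>b\<in>UNIV. (cmod (cinner_vec (B b) x))\<^sup>2)"
    by (simp add: cinner_vec_linear cnj_mult_self)
  finally show ?thesis
    by (simp only: of_real_eq_iff)
qed

lemma trace_orthonormal:
  fixes A :: "complex ^ 'n ^ 'n"
  assumes "orthonormal_basis B"
  shows "trace A = (\<Sum>b\<in>UNIV. cinner_vec (B b) (A *v B b))"
proof -
  define V where "V = (\<chi> i j. B j $ i)"
  have "trace A = trace (A ** (V ** adjoint_mat V))"
    using orthonormal_matrix(2)[OF assms] by (simp add: V_def)
  also have "\<dots> = trace (adjoint_mat V ** (A ** V))"
    by (metis matrix_mul_assoc trace_mul_sym)
  also have "\<dots> = (\<Sum>b\<in>UNIV. cinner_vec (B b) (A *v B b))"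
    by (simp add: V_def trace_def adjoint_mat_def matrix_matrix_mult_def
        matrix_vector_mult_def cinner_vec_def)
  finally show ?thesis .
qed

section \<open>Overlaps with nearly orthogonal unit vectors\<close>

text \<open>A row-sum bound on the largest eigenvalue of the Gram matrix: every row has diagonal
  entry 1 and \<open>card J - 1\<close> further entries of modulus at most
  \<open>\<mu>\<close>.\<close>

lemma norm_lincomb_le:
  fixes v :: "'i \<Rightarrow> complex ^ 'n" and \<mu> :: real
  assumes "finite J" "J \<noteq> {}" and unit: "\<And>i. i \<in> J \<Longrightarrow> norm (v i) = 1"
    and ov: "\<And>i j. i \<in> J \<Longrightarrow> j \<in> J \<Longrightarrow> i \<noteq> j \<Longrightarrow> cmod (cinner_vec (v i) (v j)) \<le> \<mu>"
  shows "(norm (\<Sum>j\<in>J. c j *s v j))\<^sup>2 \<le> (1 + real (card J - 1) * \<mu>) * (\<Sum>j\<in>J. (cmod (c j))\<^sup>2)"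
proof -
  define g where "g i j = (if i = j then 1 else \<mu>)" for i j :: 'i
  have g: "cmod (cinner_vec (v i) (v j)) \<le> g i j" if "i \<in> J" "j \<in> J" for i j
    using ov[OF that] unit[OF that(1)] by (auto simp: g_def cinner_vec_self)
  have row: "(\<Sum>j\<in>J. g i j) = 1 + real (card J - 1) * \<mu>" if "i \<in> J" for i
  proof -
    have "(\<Sum>j\<in>J. g i j) = g i i + (\<Sum>j\<in>J - {i}. g i j)"
      using that \<open>finite J\<close> by (simp add: sum.remove)
    also have "(\<Sum>j\<in>J - {i}. g i j) = (\<Sum>j\<in>J - {i}. \<mu>)"
      by (intro sum.cong) (auto simp: g_def)
    finally show ?thesis
      using that \<open>finite J\<close> by (simp add: g_def)
  qed
  have sym: "g i j = g j i" for i j by (simp add: g_def)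
  have "(norm (\<Sum>j\<in>J. c j *s v j))\<^sup>2 = cmod (cinner_vec (\<Sum>j\<in>J. c j *s v j) (\<Sum>j\<in>J. c j *s v j))"
    by (simp add: cinner_vec_self norm_power)
  also have "\<dots> = cmod (\<Sum>i\<in>J. \<Sum>j\<in>J. cnj (c j) * (c i * cinner_vec (v j) (v i)))"
    by (simp add: cinner_vec_linear sum_distrib_left mult.left_commute)
  also have "\<dots> \<le> (\<Sum>i\<in>J. \<Sum>j\<in>J. cmod (c j) * (cmod (c i) * cmod (cinner_vec (v j) (v i))))"
    by (intro order_trans[OF norm_sum] sum_mono) (simp add: norm_mult)
  \<comment> \<open>The inequality between geometric and arithmetic mean separates the two
    coefficients. By symmetry of \<open>g\<close> both halves then give the same double sum, which
    contains only row sums.\<close>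
  also have "\<dots> \<le> (\<Sum>i\<in>J. \<Sum>j\<in>J. g i j * ((cmod (c i))\<^sup>2 + (cmod (c j))\<^sup>2) / 2)"
  proof (intro sum_mono)
    fix i j assume ij: "i \<in> J" "j \<in> J"
    have "2 * (cmod (c j) * cmod (c i)) \<le> (cmod (c i))\<^sup>2 + (cmod (c j))\<^sup>2"
      using sum_squares_bound[of "cmod (c j)" "cmod (c i)"] by (simp add: algebra_simps)
    moreover have "0 \<le> g i j"
      using g[OF ij] norm_ge_zero order_trans by blast
    ultimately have "g i j * (2 * (cmod (c j) * cmod (c i))) \<le> g i j * ((cmod (c i))\<^sup>2 + (cmod (c j))\<^sup>2)"
      by (rule mult_left_mono)
    moreover have "cmod (c j) * (cmod (c i) * cmod (cinner_vec (v j) (v i)))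
        \<le> cmod (c j) * (cmod (c i) * g i j)"
      using g[OF ij(2) ij(1)] by (intro mult_left_mono) (auto simp: sym)
    ultimately show "cmod (c j) * (cmod (c i) * cmod (cinner_vec (v j) (v i)))
        \<le> g i j * ((cmod (c i))\<^sup>2 + (cmod (c j))\<^sup>2) / 2"
      by (simp add: mult_ac)
  qed
  also have "\<dots> = (\<Sum>i\<in>J. \<Sum>j\<in>J. g i j * (cmod (c i))\<^sup>2 / 2) + (\<Sum>i\<in>J. \<Sum>j\<in>J. g i j * (cmod (c j))\<^sup>2 / 2)"
    by (simp add: sum.distrib add_divide_distrib distrib_left)
  also have "(\<Sum>i\<in>J. \<Sum>j\<in>J. g i j * (cmod (c j))\<^sup>2 / 2) = (\<Sum>i\<in>J. \<Sum>j\<in>J. g i j * (cmod (c i))\<^sup>2 / 2)"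
    by (subst sum.swap) (simp add: sym)
  also have "(\<Sum>i\<in>J. \<Sum>j\<in>J. g i j * (cmod (c i))\<^sup>2 / 2) + (\<Sum>i\<in>J. \<Sum>j\<in>J. g i j * (cmod (c i))\<^sup>2 / 2)
      = (\<Sum>i\<in>J. (\<Sum>j\<in>J. g i j) * (cmod (c i))\<^sup>2)"
    by (simp add: sum.distrib[symmetric] sum_distrib_right)
  also have "\<dots> = (1 + real (card J - 1) * \<mu>) * (\<Sum>j\<in>J. (cmod (c j))\<^sup>2)"
    by (simp add: row sum_distrib_left)
  finally show ?thesis .
qed

text \<open>The dual of the preceding bound: the map from coefficients to linear combinations and
  its adjoint, which takes \<open>x\<close> to its overlaps, have the same norm. It follows from
  expanding the square of the norm of \<open>K x - \<phi>\<close>, which is nonnegative.\<close>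

lemma sum_overlaps_le:
  fixes v :: "'i \<Rightarrow> complex ^ 'n" and \<mu> :: real
  assumes "finite J" "J \<noteq> {}" "0 \<le> \<mu>" and unit: "\<And>i. i \<in> J \<Longrightarrow> norm (v i) = 1"
    and ov: "\<And>i j. i \<in> J \<Longrightarrow> j \<in> J \<Longrightarrow> i \<noteq> j \<Longrightarrow> cmod (cinner_vec (v i) (v j)) \<le> \<mu>"
  shows "(\<Sum>j\<in>J. (cmod (cinner_vec (v j) x))\<^sup>2) \<le> (1 + real (card J - 1) * \<mu>) * (norm x)\<^sup>2"
proof -
  define K where "K = 1 + real (card J - 1) * \<mu>"
  define S where "S = (\<Sum>j\<in>J. (cmod (cinner_vec (v j) x))\<^sup>2)"
  define \<phi> where "\<phi> = (\<Sum>j\<in>J. cinner_vec (v j) x *s v j)"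
  have K: "K > 0"
    using \<open>0 \<le> \<mu>\<close> by (simp add: K_def add_pos_nonneg)
  have \<phi>x: "cinner_vec \<phi> x = of_real S"
    by (simp add: \<phi>_def S_def cinner_vec_linear cnj_mult_self)
  then have x\<phi>: "cinner_vec x \<phi> = of_real S"
    by (metis cnj_cinner_vec complex_cnj_complex_of_real)
  let ?w = "of_real K *s x + (- \<phi>)"
  have "of_real ((norm ?w)\<^sup>2) = complex_of_real (K\<^sup>2 * (norm x)\<^sup>2 - 2 * K * S + (norm \<phi>)\<^sup>2)"
    unfolding cinner_vec_self[symmetric] cinner_vec_linear \<phi>x x\<phi>
    by (simp add: cinner_vec_self power2_eq_square algebra_simps)
  then have "(norm ?w)\<^sup>2 = K\<^sup>2 * (norm x)\<^sup>2 - 2 * K * S + (norm \<phi>)\<^sup>2"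
    by (simp only: of_real_eq_iff)
  moreover have "(norm \<phi>)\<^sup>2 \<le> K * S"
    unfolding \<phi>_def S_def K_def using assms by (intro norm_lincomb_le) auto
  ultimately have "K * S \<le> K * (K * (norm x)\<^sup>2)"
    using zero_le_power2[of "norm ?w"] unfolding power2_eq_square by (simp only: algebra_simps)
  then show ?thesis
    using K by (simp add: K_def S_def)
qed

section \<open>Joint eigenbases of two-qubit stabilizer groups\<close>

text \<open>For admissible signs this is the average over the stabilizer group formed by the
  identity and the signed operators. It is a map on vectors because the operator algebra below is
  carried out on words applied to a vector.\<close>

definition stab_proj :: "(nat \<Rightarrow> complex ^ 4 ^ 4) \<Rightarrow> (nat \<Rightarrow> complex) \<Rightarrow> complex ^ 4 \<Rightarrow> complex ^ 4" where
  "stab_proj A t x = (1 / 4) *s (x + (\<Sum>k<3. t k *s (A k *v x)))"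

lemma lessThan_3: "{..<3::nat} = {0, 1, 2}"
  by auto

lemma eigenvalue_involution:
  assumes "A ** A = mat 1" "eigenvector_of A x"
  obtains c where "c = 1 \<or> c = -1" "A *v x = c *s x"
proof -
  obtain c where c: "A *v x = c *s x" and x: "x \<noteq> 0"
    using assms(2) by (auto simp: eigenvector_of_def)
  have "x = A *v (A *v x)"
    by (simp add: matrix_vector_mul_assoc assms(1))
  also have "\<dots> = (c * c) *s x"
    by (simp add: c matrix_vector_mult_scale vector_smult_assoc)
  finally have "(c * c - 1) *s x = 0"
    by (metis add_diff_cancel_left' diff_add_cancel diff_self vector_sadd_rdistrib vector_smult_lid)
  then have "c * c = 1"
    using x by (auto simp: vec_eq_iff)
  then have "c = 1 \<or> c = -1"
    by (simp add: square_eq_1_iff)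
  with c that show thesis by blast
qed

text \<open>Conjugation by \<open>C\<close> preserves the trace and turns \<open>A\<close> into
  \<open>- A\<close>.\<close>

lemma trace_anticommuting_involution:
  fixes A C :: "complex ^ 'n ^ 'n"
  assumes "C ** C = mat 1" and anti: "C ** A = - (A ** C)"
  shows "trace A = 0"
proof -
  have "trace A = trace (C ** (A ** C))"
    by (metis assms(1) matrix_mul_assoc matrix_mul_rid trace_mul_sym)
  also have "C ** (A ** C) = - A"
  proof -
    have "(C ** (A ** C)) *v x = (- A) *v x" for x
    proof -
      have "C *v (A *v y) = - (A *v (C *v y))" for y
        using arg_cong[OF anti, of "\<lambda>M. M *v y"]
        by (simp add: matrix_vector_mul_assoc neg_matrix_vector_mult)
      moreover have "C *v (C *v x) = x"
        by (simp add: matrix_vector_mul_assoc assms(1))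
      ultimately show ?thesis
        by (simp add: matrix_vector_mul_assoc[symmetric] neg_matrix_vector_mult)
    qed
    then show ?thesis by (simp add: matrix_eq)
  qed
  finally show ?thesis
    by (simp add: trace_def sum_negf)
qed

locale stabilizer =
  fixes A :: "nat \<Rightarrow> complex ^ 4 ^ 4" and s :: complex and B :: "4 \<Rightarrow> complex ^ 4"
  assumes invol: "k < 3 \<Longrightarrow> A k ** A k = mat 1"
    and prod3: "A 0 *v (A 1 *v (A 2 *v x)) = s *s x"
    and tr0: "k < 3 \<Longrightarrow> trace (A k) = 0"
    and eb: "common_eigenbasis {A 0, A 1, A 2} B"
begin

lemma onb: "orthonormal_basis B"
  using eb by (simp add: common_eigenbasis_def)

lemma eigenvalues:
  obtains a where "\<And>\<beta> k. k < 3 \<Longrightarrow> a \<beta> k = 1 \<or> a \<beta> k = -1"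
    "\<And>\<beta> k. k < 3 \<Longrightarrow> A k *v B \<beta> = a \<beta> k *s B \<beta>"
    "\<And>\<beta>. a \<beta> 0 * a \<beta> 1 * a \<beta> 2 = s"
proof -
  have "\<exists>c. k < 3 \<longrightarrow> (c = 1 \<or> c = -1) \<and> A k *v B \<beta> = c *s B \<beta>" for \<beta> k
  proof (cases "k < 3")
    case True
    then have "k = 0 \<or> k = 1 \<or> k = 2"
      by linarith
    then have "eigenvector_of (A k) (B \<beta>)"
      using eb by (auto simp: common_eigenbasis_def)
    then show ?thesis
      using eigenvalue_involution[OF invol[OF True]] by metis
  qed auto
  then have "\<exists>a. \<forall>\<beta> k. k < 3 \<longrightarrow> (a \<beta> k = 1 \<or> a \<beta> k = -1) \<and> A k *v B \<beta> = a \<beta> k *s B \<beta>"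
    by (intro choice allI)
  then obtain a where a: "\<And>\<beta> k. k < 3 \<Longrightarrow> a \<beta> k = 1 \<or> a \<beta> k = -1"
    "\<And>\<beta> k. k < 3 \<Longrightarrow> A k *v B \<beta> = a \<beta> k *s B \<beta>"
    by auto
  have "a \<beta> 0 * a \<beta> 1 * a \<beta> 2 = s" for \<beta>
  proof -
    \<comment> \<open>The triple product is evaluated in a basis vector twice: as the scalar
      \<open>s\<close>, and through the three eigenvalues.\<close>
    have "s = cinner_vec (B \<beta>) (A 0 *v (A 1 *v (A 2 *v B \<beta>)))"
      using orthonormal_cinner[OF onb, of \<beta> \<beta>] by (simp add: prod3 cinner_vec_linear del: One_nat_def)
    also have "\<dots> = a \<beta> 0 * a \<beta> 1 * a \<beta> 2"
      using orthonormal_cinner[OF onb, of \<beta> \<beta>]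
      by (simp add: a(2) matrix_vector_mult_scale cinner_vec_linear)
    finally show ?thesis by simp
  qed
  with a that show thesis by blast
qed

lemma stab_proj_sum:
  assumes "\<And>\<beta>. stab_proj A t (B \<beta>) = n \<beta> *s B \<beta>"
  shows "stab_proj A t x = (\<Sum>\<beta>\<in>UNIV. (cinner_vec (B \<beta>) x * n \<beta>) *s B \<beta>)"
proof -
  have lin: "stab_proj A t (\<Sum>\<beta>\<in>UNIV. c \<beta> *s B \<beta>) = (\<Sum>\<beta>\<in>UNIV. c \<beta> *s stab_proj A t (B \<beta>))" for c
    by (simp add: stab_proj_def lessThan_3 matrix_vector_mult_sum matrix_vector_mult_scale
        vec_eq_iff sum.distrib algebra_simps sum_distrib_left)
  show ?thesis
    using lin[of "\<lambda>\<beta>. cinner_vec (B \<beta>) x"]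
    by (simp add: orthonormal_expansion[OF onb] assms vector_smult_assoc)
qed

text \<open>The operator is diagonal in \<open>B\<close> with eigenvalues 0 and 1, and its trace is
  1, so exactly one basis vector survives. The second conclusion serves to recognize that
  vector.\<close>

lemma rank_one:
  assumes t: "\<And>k. k < 3 \<Longrightarrow> t k = 1 \<or> t k = -1" "t 0 * t 1 * t 2 = s"
  obtains \<beta> where "\<And>x. stab_proj A t x = cinner_vec (B \<beta>) x *s B \<beta>"
    "\<And>\<gamma>. stab_proj A t (B \<gamma>) = B \<gamma> \<Longrightarrow> \<gamma> = \<beta>"
proof -
  obtain a where a: "\<And>\<beta> k. k < 3 \<Longrightarrow> a \<beta> k = 1 \<or> a \<beta> k = -1"
    "\<And>\<beta> k. k < 3 \<Longrightarrow> A k *v B \<beta> = a \<beta> k *s B \<beta>"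
    "\<And>\<beta>. a \<beta> 0 * a \<beta> 1 * a \<beta> 2 = s"
    using eigenvalues by metis
  define n where "n \<beta> = (1 / 4) * (1 + (\<Sum>k<3. t k * a \<beta> k))" for \<beta>
  have n: "stab_proj A t (B \<beta>) = n \<beta> *s B \<beta>" for \<beta>
    by (simp add: stab_proj_def n_def lessThan_3 a(2) vec_eq_iff algebra_simps)
  \<comment> \<open>The three signs \<open>t k * a \<beta> k\<close> have product
    \<open>s * s = 1\<close>. Either all are 1, with sum 3, or exactly one is, with sum -1.\<close>
  have n01: "n \<beta> = 0 \<or> n \<beta> = 1" for \<beta>
    using t(1)[of 0] t(1)[of 1] t(1)[of 2] a(1)[of 0 \<beta>] a(1)[of 1 \<beta>] a(1)[of 2 \<beta>]
      t(2) a(3)[of \<beta>]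
    by (auto simp: n_def lessThan_3)
  have tr: "(\<Sum>\<beta>\<in>UNIV. a \<beta> k) = 0" if "k < 3" for k
  proof -
    have "a \<beta> k = cinner_vec (B \<beta>) (A k *v B \<beta>)" for \<beta>
      using orthonormal_cinner[OF onb, of \<beta> \<beta>] by (simp add: a(2) that cinner_vec_linear)
    then show ?thesis
      using trace_orthonormal[OF onb, of "A k"] tr0[OF that] by simp
  qed
  \<comment> \<open>Only the identity contributes to the trace: 4 times 1/4.\<close>
  have "(\<Sum>\<beta>\<in>UNIV. n \<beta>) = 1"
    using tr[of 0] tr[of 1] tr[of 2]
    by (simp add: n_def lessThan_3 sum.distrib sum_distrib_left[symmetric]
        sum_divide_distrib[symmetric])
  moreover have "(\<Sum>\<beta>\<in>UNIV. n \<beta>) = of_nat (card {\<beta>. n \<beta> = 1})"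
  proof -
    have "(\<Sum>\<beta>\<in>UNIV. n \<beta>) = (\<Sum>\<beta>\<in>UNIV. if n \<beta> = 1 then 1 else 0)"
      using n01 by (intro sum.cong refl) metis
    then show ?thesis
      by (simp add: sum.If_cases)
  qed
  ultimately have "card {\<beta>. n \<beta> = 1} = 1"
    by (metis of_nat_1_eq_iff)
  then obtain \<beta> where \<beta>: "{\<beta>. n \<beta> = 1} = {\<beta>}"
    by (auto simp: card_1_singleton_iff)
  then have nb: "n \<gamma> = (if \<gamma> = \<beta> then 1 else 0)" for \<gamma>
    using n01 by auto
  have "stab_proj A t x = cinner_vec (B \<beta>) x *s B \<beta>" for x
  proof -
    have "stab_proj A t x = (\<Sum>\<gamma>\<in>UNIV. if \<gamma> = \<beta> then cinner_vec (B \<gamma>) x *s B \<gamma> else 0)"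
      unfolding stab_proj_sum[OF n] by (intro sum.cong) (auto simp: nb)
    then show ?thesis by simp
  qed
  moreover have "\<gamma> = \<beta>" if "stab_proj A t (B \<gamma>) = B \<gamma>" for \<gamma>
  proof (rule ccontr)
    assume "\<gamma> \<noteq> \<beta>"
    then have "B \<gamma> = 0"
      using that n[of \<gamma>] by (simp add: nb)
    then show False
      using orthonormal_cinner[OF onb, of \<gamma> \<gamma>] by (simp add: cinner_vec_zero_left)
  qed
  ultimately show thesis
    using that by blast
qed

text \<open>With the eigenvalues of \<open>B \<beta>\<close> itself as signs the operator fixes
  \<open>B \<beta>\<close>, so \<open>rank_one\<close> must single out this index.\<close>

lemma basis_vector_projector:
  obtains t where "\<And>x. stab_proj A t x = cinner_vec (B \<beta>) x *s B \<beta>"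
proof -
  obtain a where a: "\<And>\<beta> k. k < 3 \<Longrightarrow> a \<beta> k = 1 \<or> a \<beta> k = -1"
    "\<And>\<beta> k. k < 3 \<Longrightarrow> A k *v B \<beta> = a \<beta> k *s B \<beta>"
    "\<And>\<beta>. a \<beta> 0 * a \<beta> 1 * a \<beta> 2 = s"
    using eigenvalues by metis
  have sq: "a \<beta> k * a \<beta> k = 1" if "k < 3" for k
    using a(1)[OF that, of \<beta>] by auto
  have "stab_proj A (a \<beta>) (B \<beta>) = B \<beta>"
    by (simp add: stab_proj_def lessThan_3 a(2) vec_eq_iff sq mult.assoc[symmetric])
  then show thesis
    using rank_one[of "a \<beta>"] a that by metis
qed

end

section \<open>The four classes\<close>

locale clifford4 =
  fixes \<Gamma> :: "nat \<Rightarrow> complex ^ 4 ^ 4"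
  assumes herm: "j < 4 \<Longrightarrow> hermitian_mat (\<Gamma> j)"
    and square: "j < 4 \<Longrightarrow> \<Gamma> j ** \<Gamma> j = mat 1"
    and anticomm: "j < 4 \<Longrightarrow> k < 4 \<Longrightarrow> j \<noteq> k \<Longrightarrow> \<Gamma> j ** \<Gamma> k = - (\<Gamma> k ** \<Gamma> j)"
    and gamma4: "\<Gamma> 4 = \<Gamma> 0 ** \<Gamma> 1 ** \<Gamma> 2 ** \<Gamma> 3"
begin

text \<open>Indices modulo 4 give one formula for all four classes and display the cyclic symmetry
  that \<open>U\<close> implements.\<close>

definition T :: "nat \<Rightarrow> nat \<Rightarrow> complex ^ 4 ^ 4" where
  "T j k = (if k = 0 then \<Gamma> j
    else if k = 1 then \<i> \<cdot>\<^sub>m (\<Gamma> ((j + 1) mod 4) ** \<Gamma> 4)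
    else \<i> \<cdot>\<^sub>m (\<Gamma> ((j + 2) mod 4) ** \<Gamma> ((j + 3) mod 4)))"

lemma T_table:
  "T 0 0 = \<Gamma> 0" "T 0 1 = \<i> \<cdot>\<^sub>m (\<Gamma> 1 ** \<Gamma> 4)" "T 0 2 = \<i> \<cdot>\<^sub>m (\<Gamma> 2 ** \<Gamma> 3)"
  "T 1 0 = \<Gamma> 1" "T 1 1 = \<i> \<cdot>\<^sub>m (\<Gamma> 2 ** \<Gamma> 4)" "T 1 2 = \<i> \<cdot>\<^sub>m (\<Gamma> 3 ** \<Gamma> 0)"
  "T 2 0 = \<Gamma> 2" "T 2 1 = \<i> \<cdot>\<^sub>m (\<Gamma> 3 ** \<Gamma> 4)" "T 2 2 = \<i> \<cdot>\<^sub>m (\<Gamma> 0 ** \<Gamma> 1)"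
  "T 3 0 = \<Gamma> 3" "T 3 1 = \<i> \<cdot>\<^sub>m (\<Gamma> 0 ** \<Gamma> 4)" "T 3 2 = \<i> \<cdot>\<^sub>m (\<Gamma> 1 ** \<Gamma> 2)"
  by (simp_all add: T_def del: One_nat_def add_2_eq_Suc add_2_eq_Suc')

lemma gamma_square_vec: "j < 4 \<Longrightarrow> \<Gamma> j *v (\<Gamma> j *v x) = x"
  by (simp add: matrix_vector_mul_assoc square)

lemma gamma_anticomm_vec: "j < 4 \<Longrightarrow> k < 4 \<Longrightarrow> j \<noteq> k \<Longrightarrow> \<Gamma> j *v (\<Gamma> k *v x) = - (\<Gamma> k *v (\<Gamma> j *v x))"
  by (simp add: matrix_vector_mul_assoc anticomm[of j k] neg_matrix_vector_mult)

lemma gamma4_vec: "\<Gamma> 4 *v x = \<Gamma> 0 *v (\<Gamma> 1 *v (\<Gamma> 2 *v (\<Gamma> 3 *v x)))"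
  by (simp add: gamma4 matrix_vector_mul_assoc matrix_mul_assoc)

lemmas linear = matrix_vector_mult_neg matrix_vector_mult_scale matrix_vector_right_distrib
  matrix_vector_mult_diff_distrib neg_matrix_vector_mult scale_mat_vector_mult
  matrix_vector_mul_assoc[symmetric]

text \<open>Rewriting with these rules brings words in the generators into the order
  \<open>\<Gamma>\<^sub>1, \<Gamma>\<^sub>2, \<Gamma>\<^sub>3, \<Gamma>\<^sub>0\<close>, so that \<open>\<Gamma>\<^sub>3\<close> and \<open>\<Gamma>\<^sub>0\<close>
  meet a vector whose images under them are known.\<close>

lemmas normal_order =
  gamma_square_vec[of 0] gamma_square_vec[of 1] gamma_square_vec[of 2] gamma_square_vec[of 3]
  gamma_anticomm_vec[of 0 1] gamma_anticomm_vec[of 0 2] gamma_anticomm_vec[of 0 3]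
  gamma_anticomm_vec[of 2 1] gamma_anticomm_vec[of 3 1] gamma_anticomm_vec[of 3 2]
  gamma4_vec

lemma less4_cases: "(j::nat) < 4 \<Longrightarrow> j = 0 \<or> j = 1 \<or> j = 2 \<or> j = 3"
  by linarith

lemma less3_cases: "(j::nat) < 3 \<Longrightarrow> j = 0 \<or> j = 1 \<or> j = 2"
  by linarith

text \<open>A product of two anticommuting involutions squares to -1, which the factor
  \<open>\<i>\<close> corrects. \<open>\<Gamma> 4\<close> is itself an involution anticommuting with
  the four generators.\<close>

lemma T_square_vec:
  assumes "j < 4" "k < 3" shows "T j k *v (T j k *v x) = x"
  using less4_cases[OF assms(1)] less3_cases[OF assms(2)]
  by (elim disjE) (simp_all add: T_table linear normal_order del: One_nat_def)

lemma T_square: "j < 4 \<Longrightarrow> k < 3 \<Longrightarrow> T j k ** T j k = mat 1"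
  by (simp add: matrix_eq matrix_vector_mul_assoc[symmetric] T_square_vec)

text \<open>The sign alternates because a cyclic shift of the generators moves one factor of
  \<open>\<Gamma> 4\<close> past three others and so reverses its sign.\<close>

lemma T_prod:
  assumes "j < 4" shows "T j 0 *v (T j 1 *v (T j 2 *v x)) = (-1) ^ (j + 1) *s x"
  using less4_cases[OF assms]
  by (elim disjE) (simp_all add: T_table linear normal_order del: One_nat_def)

lemma T_hermitian:
  assumes "j < 4" "k < 3" shows "hermitian_mat (T j k)"
  using less4_cases[OF assms(1)] less3_cases[OF assms(2)]
  by (intro hermitianI_cinner, elim disjE)
    (simp_all add: T_table linear normal_order cinner_vec_linear cinner_vec_hermitian herm
      del: One_nat_def)

text \<open>Operators in the same position of two classes anticommute, except for products of two
  generators with disjoint index pairs. In that case the generator \<open>T l 0\<close> works, since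
  it is one factor of \<open>T j 2\<close>.\<close>

lemma T_anticomm_vec:
  assumes "j < 4" "l < 4" "j \<noteq> l" "k < 3"
  defines "m \<equiv> (if k = 2 \<and> l = (j + 2) mod 4 then 0 else k)"
  shows "T l m *v (T j k *v x) = - (T j k *v (T l m *v x))"
  using less4_cases[OF assms(1)] less4_cases[OF assms(2)] less3_cases[OF assms(4)] \<open>j \<noteq> l\<close>
  unfolding m_def
  by (elim disjE) (simp_all add: T_table linear normal_order del: One_nat_def)

lemma T_anticomm:
  assumes "j < 4" "l < 4" "j \<noteq> l" "k < 3"
  obtains m where "m < 3" "\<And>x. T l m *v (T j k *v x) = - (T j k *v (T l m *v x))"
  using that[OF _ T_anticomm_vec[OF assms]] assms(4) by simp

lemma T_trace:
  assumes "j < 4" "k < 3" shows "trace (T j k) = 0"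
proof -
  obtain l :: nat where l: "l < 4" "j \<noteq> l"
    using that[of 0] that[of 1] by fastforce
  obtain m where m: "m < 3" "\<And>x. T l m *v (T j k *v x) = - (T j k *v (T l m *v x))"
    using T_anticomm[OF assms(1) l assms(2)] by metis
  have "T l m ** T j k = - (T j k ** T l m)"
    by (simp add: matrix_eq matrix_vector_mul_assoc[symmetric] m(2) neg_matrix_vector_mult)
  then show ?thesis
    using T_square[OF l(1) m(1)] trace_anticommuting_involution by blast
qed

lemma stabilizer_T:
  assumes "j < 4" "common_eigenbasis {T j 0, T j 1, T j 2} B"
  shows "stabilizer (T j) ((-1) ^ (j + 1)) B"
  using assms T_square T_prod T_trace by unfold_locales auto

text \<open>The squared overlap is the mean of the projector onto \<open>B \<beta>\<close> in the
  state \<open>C \<gamma>\<close>. Only the identity term, of weight 1/4, contributes.\<close>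

lemma mutually_unbiased:
  assumes jl: "j < 4" "l < 4" "j \<noteq> l"
    and B: "common_eigenbasis {T j 0, T j 1, T j 2} B"
    and C: "common_eigenbasis {T l 0, T l 1, T l 2} C"
  shows "cmod (cinner_vec (B \<beta>) (C \<gamma>)) = 1 / 2"
proof -
  interpret B: stabilizer "T j" "(-1) ^ (j + 1)" B
    by (rule stabilizer_T[OF jl(1) B])
  interpret C: stabilizer "T l" "(-1) ^ (l + 1)" C
    by (rule stabilizer_T[OF jl(2) C])
  let ?x = "C \<gamma>"
  have xx: "cinner_vec ?x ?x = 1"
    using orthonormal_cinner[OF C.onb] by simp
  obtain t where t: "\<And>x. stab_proj (T j) t x = cinner_vec (B \<beta>) x *s B \<beta>"
    using B.basis_vector_projector by metis
  have ev0: "cinner_vec ?x (T j k *v ?x) = 0" if k: "k < 3" for k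
  proof -
    obtain m where m: "m < 3" "\<And>x. T l m *v (T j k *v x) = - (T j k *v (T l m *v x))"
      using T_anticomm[OF jl k] by metis
    obtain c where c: "c = 1 \<or> c = -1" "T l m *v ?x = c *s ?x"
      using C.eigenvalues m(1) by metis
    \<comment> \<open>Since \<open>?x\<close> is an eigenvector of \<open>T l m\<close> with a real
      nonzero eigenvalue, the mean equals its own negative.\<close>
    have "cinner_vec (T l m *v ?x) (T j k *v ?x) = - cinner_vec ?x (T j k *v (T l m *v ?x))"
      by (simp add: cinner_vec_hermitian T_hermitian jl m cinner_vec_linear)
    then show ?thesis
      using c by (auto simp: linear cinner_vec_linear)
  qed
  have "complex_of_real ((cmod (cinner_vec (B \<beta>) ?x))\<^sup>2) = cinner_vec ?x (stab_proj (T j) t ?x)"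
    by (simp only: t cinner_vec_linear cinner_vec_mult_swap)
  also have "\<dots> = of_real (1 / 4)"
    by (simp add: stab_proj_def cinner_vec_linear xx ev0)
  finally have "(cmod (cinner_vec (B \<beta>) ?x))\<^sup>2 = (1 / 2)\<^sup>2"
    by (simp only: of_real_eq_iff) (simp add: power2_eq_square)
  then show ?thesis
    by (rule power2_eq_imp_eq) auto
qed

text \<open>Conjugation by \<open>U\<close> negates \<open>\<Gamma> 4\<close>, which occurs only in
  the operator with index 1 (as a separate factor). The alternating sign there compensates for this
  and gives the product required by \<open>T_prod\<close>.\<close>

definition sgn_choice :: "nat \<Rightarrow> nat \<Rightarrow> complex" where
  "sgn_choice j k = (if k = 1 then (-1) ^ (j + 1) else 1)"

abbreviation P :: "nat \<Rightarrow> complex ^ 4 \<Rightarrow> complex ^ 4" where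
  "P j \<equiv> stab_proj (T j) (sgn_choice j)"

lemma P_add: "P j (x + y) = P j x + P j y"
  by (simp add: stab_proj_def lessThan_3 linear vec_eq_iff algebra_simps)

lemma P_scale: "P j (c *s x) = c *s P j x"
  by (simp add: stab_proj_def lessThan_3 linear vec_eq_iff algebra_simps)

lemma P_expand:
  "P 0 x = (1 / 4) *s (x + (T 0 0 *v x + (- (T 0 1 *v x) + T 0 2 *v x)))"
  "P 1 x = (1 / 4) *s (x + (T 1 0 *v x + (T 1 1 *v x + T 1 2 *v x)))"
  "P 2 x = (1 / 4) *s (x + (T 2 0 *v x + (- (T 2 1 *v x) + T 2 2 *v x)))"
  "P 3 x = (1 / 4) *s (x + (T 3 0 *v x + (T 3 1 *v x + T 3 2 *v x)))"
  by (simp_all add: stab_proj_def sgn_choice_def lessThan_3 vec_eq_iff algebra_simps)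

text \<open>The stabilizer relations for \<open>T 0 0\<close> and \<open>T 0 2\<close> on the range
  of \<open>P 0\<close>, solved for \<open>\<Gamma> 0\<close> and \<open>\<Gamma> 3\<close>. With
  them every normally ordered word on such a vector reduces to one in \<open>\<Gamma> 1\<close> and
  \<open>\<Gamma> 2\<close>.\<close>

lemma gamma_P0:
  "\<Gamma> 0 *v P 0 x = P 0 x"
  "\<Gamma> 3 *v P 0 x = (- \<i>) *s (\<Gamma> 2 *v P 0 x)"
  by (simp_all add: P_expand T_table linear normal_order del: One_nat_def)

text \<open>For \<open>e\<close> spanning the range of \<open>P 0\<close>, the equations with factor
  1/2 make the cyclic triple products of overlaps positive. Hence the four vectors can be rephased
  so that all their mutual inner products are +1/2, the extremal case of the Gram bound.\<close>

lemma P_triple: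
  assumes e: "\<Gamma> 0 *v e = e" "\<Gamma> 3 *v e = (- \<i>) *s (\<Gamma> 2 *v e)"
  shows "P 0 (P 1 e) = (1 / 4) *s e" "P 0 (P 2 e) = (1 / 4) *s e" "P 0 (P 3 e) = (1 / 4) *s e"
    "P 1 (P 2 e) = (1 / 2) *s P 1 e" "P 1 (P 3 e) = (1 / 2) *s P 1 e"
    "P 2 (P 1 e) = (1 / 2) *s P 2 e" "P 2 (P 3 e) = (1 / 2) *s P 2 e"
    "P 3 (P 1 e) = (1 / 2) *s P 3 e" "P 3 (P 2 e) = (1 / 2) *s P 3 e"
  by (simp_all add: P_expand T_table linear normal_order e del: One_nat_def)
    (simp_all add: vec_eq_iff field_simps)

lemma U_P:
  assumes U: "\<And>j x. j < 4 \<Longrightarrow> U *v (\<Gamma> j *v x) = \<Gamma> ((j + 1) mod 4) *v (U *v x)"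
  shows "U *v P 0 x = P 1 (U *v x)" "U *v P 1 x = P 2 (U *v x)"
    "U *v P 2 x = P 3 (U *v x)" "U *v P 3 x = P 0 (U *v x)"
proof -
  have U': "U *v (\<Gamma> 0 *v x) = \<Gamma> 1 *v (U *v x)" "U *v (\<Gamma> 1 *v x) = \<Gamma> 2 *v (U *v x)"
    "U *v (\<Gamma> 2 *v x) = \<Gamma> 3 *v (U *v x)" "U *v (\<Gamma> 3 *v x) = \<Gamma> 0 *v (U *v x)" for x
    using U[of 0 x] U[of 1 x] U[of 2 x] U[of 3 x] by (simp_all del: One_nat_def)
  show "U *v P 0 x = P 1 (U *v x)" "U *v P 1 x = P 2 (U *v x)"
    "U *v P 2 x = P 3 (U *v x)" "U *v P 3 x = P 0 (U *v x)"
    by (simp_all add: P_expand T_table linear normal_order U' del: One_nat_def)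
qed

lemma symmetric_state:
  assumes B: "\<And>j. j < 4 \<Longrightarrow> common_eigenbasis {T j 0, T j 1, T j 2} (B j)"
    and U: "\<And>j x. j < 4 \<Longrightarrow> U *v (\<Gamma> j *v x) = \<Gamma> ((j + 1) mod 4) *v (U *v x)"
  obtains \<psi> \<beta> where "norm \<psi> = 1" "eigenvector_of U \<psi>"
    "\<And>j. j < 4 \<Longrightarrow> (cmod (cinner_vec (B j (\<beta> j)) \<psi>))\<^sup>2 = 5 / 8"
proof -
  have "\<exists>\<beta>. \<forall>x. P j x = cinner_vec (B j \<beta>) x *s B j \<beta>" if "j < 4" for j
  proof -
    interpret stabilizer "T j" "(-1) ^ (j + 1)" "B j"
      by (rule stabilizer_T[OF that B[OF that]])
    have "sgn_choice j k = 1 \<or> sgn_choice j k = -1" for k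
      by (cases "even j") (auto simp: sgn_choice_def)
    moreover have "sgn_choice j 0 * sgn_choice j 1 * sgn_choice j 2 = (-1) ^ (j + 1)"
      by (simp add: sgn_choice_def)
    ultimately obtain \<gamma> where "\<And>x. P j x = cinner_vec (B j \<gamma>) x *s B j \<gamma>"
      using rank_one[of "sgn_choice j"] by blast
    then show ?thesis
      by blast
  qed
  then obtain \<beta> where \<beta>: "\<And>j x. j < 4 \<Longrightarrow> P j x = cinner_vec (B j (\<beta> j)) x *s B j (\<beta> j)"
    by metis
  define b where "b j = B j (\<beta> j)" for j
  have Pb: "P j x = cinner_vec (b j) x *s b j" if "j < 4" for j x
    by (simp add: \<beta> that b_def)
  have bb: "cinner_vec (b j) (b j) = 1" if "j < 4" for j
    using B[OF that] by (simp add: b_def common_eigenbasis_def orthonormal_cinner)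
  have inner_P: "cinner_vec (b j) (P j x) = cinner_vec (b j) x" if "j < 4" for j x
    by (simp add: Pb bb that cinner_vec_linear)
  define e where "e = b 0"
  define c where "c j = cinner_vec (b j) e" for j
  have c: "cmod (c j) = 1 / 2" if "j \<in> {1, 2, 3}" for j
    unfolding c_def e_def b_def using that by (intro mutually_unbiased[of j 0] B) auto
  have P0e: "P 0 e = e"
    by (simp add: Pb e_def bb)
  have e: "\<Gamma> 0 *v e = e" "\<Gamma> 3 *v e = (- \<i>) *s (\<Gamma> 2 *v e)"
    using gamma_P0[of e] by (simp_all add: P0e)
  note triple = P_triple[OF e]
  have idem: "P j (P j e) = P j e" if "j < 4" for j
    by (simp add: Pb bb that cinner_vec_linear)
  \<comment> \<open>Each \<open>P j e\<close> has norm 1/2, so \<open>w\<close> is the sum of four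
    unit vectors with mutual inner products 1/2. Its overlap with each has modulus 1 + 3/2 = 5/2,
    and its squared norm is 4 times 5/2.\<close>
  define w where "w = e + 2 *s (P 1 e + (P 2 e + P 3 e))"
  have Pw0: "P 0 w = (5 / 2) *s e"
    by (simp add: w_def P_add P_scale triple P0e del: One_nat_def)
      (simp add: vec_eq_iff field_simps)
  have "P 1 w = 5 *s P 1 e" "P 2 w = 5 *s P 2 e" "P 3 w = 5 *s P 3 e"
    by (simp_all add: w_def P_add P_scale triple idem del: One_nat_def)
      (simp_all add: vec_eq_iff field_simps)
  then have Pw: "P j w = 5 *s P j e" if "j \<in> {1, 2, 3}" for j
    using that by auto
  have bw0: "cinner_vec (b 0) w = 5 / 2"
    using inner_P[of 0 w] bb[of 0] by (simp add: Pw0 cinner_vec_linear e_def)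
  have bw: "cinner_vec (b j) w = 5 * c j" if "j \<in> {1, 2, 3}" for j
    using inner_P[of j w] inner_P[of j e] that by (auto simp: Pw cinner_vec_linear c_def)
  have Pe_w: "cinner_vec (P j e) w = 5 / 4" if "j \<in> {1, 2, 3}" for j
  proof -
    have "cinner_vec (P j e) w = 5 * (cnj (c j) * c j)"
      using that by (auto simp: Pb cinner_vec_linear bw c_def)
    then show ?thesis
      using c[OF that] by (simp add: cnj_mult_self power2_eq_square)
  qed
  have "complex_of_real ((norm w)\<^sup>2) = cinner_vec w w"
    by (simp add: cinner_vec_self)
  also have "\<dots> = cinner_vec (e + 2 *s (P 1 e + (P 2 e + P 3 e))) w"
    by (subst w_def) (rule refl)
  also have "\<dots> = of_real 10"
    unfolding cinner_vec_linear by (simp add: Pe_w bw0[folded e_def] del: One_nat_def)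
  finally have w2: "(norm w)\<^sup>2 = 10"
    by (simp only: of_real_eq_iff)
  have Uw: "\<exists>d. U *v w = d *s w"
  proof -
    have "U *v e = P 1 (U *v e)"
      using U_P(1)[OF U, of e] by (simp add: P0e)
    also have "\<dots> = (cinner_vec (b 1) (U *v e) / c 1) *s P 1 e"
      using c[of 1] by (auto simp: Pb c_def vector_smult_assoc)
    \<comment> \<open>Then \<open>U\<close> sends \<open>P 1 e\<close> and \<open>P 2 e\<close> to
      \<theta>/2 times \<open>P 2 e\<close> and \<open>P 3 e\<close>, and \<open>P 3 e\<close> to
      \<theta>/4 times \<open>e\<close>. These weights reproduce \<open>w\<close> with eigenvalue
      \<theta>/2.\<close>
    finally obtain \<theta> where \<theta>: "U *v e = \<theta> *s P 1 e"
      by blast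
    have "U *v w = (\<theta> / 2) *s w"
      by (simp add: w_def linear U_P[OF U] \<theta> P_scale triple del: One_nat_def)
    then show ?thesis by blast
  qed
  define r where "r = complex_of_real (1 / sqrt 10)"
  have r: "cmod r = 1 / sqrt 10" "r \<noteq> 0"
    by (simp_all add: r_def norm_divide)
  define \<psi> where "\<psi> = r *s w"
  have "complex_of_real ((norm \<psi>)\<^sup>2) = of_real ((cmod r)\<^sup>2 * (norm w)\<^sup>2)"
    unfolding cinner_vec_self[symmetric] \<psi>_def cinner_vec_linear
    by (simp add: cinner_vec_self cnj_mult_self[symmetric])
  then have "(norm \<psi>)\<^sup>2 = (cmod r)\<^sup>2 * (norm w)\<^sup>2"
    by (simp only: of_real_eq_iff)
  also have "\<dots> = 1"
    by (simp add: r w2 power_divide)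
  finally have \<psi>1: "norm \<psi> = 1"
    by (simp add: power2_eq_1_iff) (smt (verit) norm_ge_zero)
  have "eigenvector_of U \<psi>"
  proof -
    obtain d where "U *v w = d *s w"
      using Uw by blast
    then have "U *v \<psi> = d *s \<psi>"
      by (simp add: \<psi>_def linear vector_smult_assoc mult.commute)
    moreover have "\<psi> \<noteq> 0"
      using \<psi>1 by auto
    ultimately show ?thesis
      by (auto simp: eigenvector_of_def)
  qed
  moreover have "(cmod (cinner_vec (B j (\<beta> j)) \<psi>))\<^sup>2 = 5 / 8" if "j < 4" for j
  proof -
    have "cmod (cinner_vec (b j) w) = 5 / 2"
    proof (cases "j = 0")
      case True
      then show ?thesis by (simp add: bw0)
    next
      case False
      then have "j \<in> {1, 2, 3}"
        using that by auto
      then show ?thesis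
        using c[of j] by (simp only: bw norm_mult) simp
    qed
    then have "cmod (cinner_vec (b j) \<psi>) = 1 / sqrt 10 * (5 / 2)"
      by (simp only: \<psi>_def cinner_vec_linear norm_mult r)
    then show ?thesis
      by (simp add: b_def power_mult_distrib power_divide)
  qed
  ultimately show thesis
    using \<psi>1 that by blast
qed

end

section \<open>The entropic uncertainty relation\<close>

text \<open>Jensen's inequality for the logarithm, obtained by summing its tangent line bound at
  \<open>t\<close>.\<close>

lemma sum_log_le:
  fixes m :: "'i \<Rightarrow> real"
  assumes "1 < a" "0 < t" "\<And>j. j \<in> J \<Longrightarrow> 0 < m j" "(\<Sum>j\<in>J. m j) \<le> real (card J) * t"
  shows "(\<Sum>j\<in>J. log a (m j)) \<le> real (card J) * log a t"
proof -
  have "(\<Sum>j\<in>J. ln (m j)) \<le> (\<Sum>j\<in>J. m j / t - 1 + ln t)"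
  proof (rule sum_mono)
    fix j assume "j \<in> J"
    then have "ln (m j / t) \<le> m j / t - 1"
      using assms by (intro ln_le_minus_one) simp
    then show "ln (m j) \<le> m j / t - 1 + ln t"
      using assms(2) assms(3)[OF \<open>j \<in> J\<close>] by (simp add: ln_div)
  qed
  also have "\<dots> = (\<Sum>j\<in>J. m j) / t - real (card J) + real (card J) * ln t"
    by (simp add: sum.distrib sum_subtractf sum_divide_distrib)
  also have "\<dots> \<le> real (card J) * ln t"
    using assms by (simp add: divide_le_eq)
  finally have "(\<Sum>j\<in>J. ln (m j)) / ln a \<le> real (card J) * ln t / ln a"
    using assms(1) by (intro divide_right_mono) auto
  then show ?thesis
    by (simp add: log_def sum_divide_distrib)
qed

text \<open>If all overlaps vanished, Parseval would force \<open>x = 0\<close>. Positivity keeps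
  the logarithm away from its default value at 0.\<close>

lemma max_overlap_pos:
  fixes B :: "'n \<Rightarrow> complex ^ 'n"
  assumes "orthonormal_basis B" "x \<noteq> 0"
  shows "0 < Max (range (\<lambda>b. (cmod (cinner_vec (B b) x))\<^sup>2))"
proof (rule ccontr)
  assume "\<not> ?thesis"
  then have "(cmod (cinner_vec (B b) x))\<^sup>2 \<le> 0" for b
    by (meson Max_ge finite finite_imageI not_less order_trans rangeI)
  then have "(\<Sum>b\<in>UNIV. (cmod (cinner_vec (B b) x))\<^sup>2) = 0"
    by simp
  then show False
    using parseval[OF assms(1), of x] assms(2) by simp
qed

lemma min_entropy_le:
  fixes B :: "'n \<Rightarrow> complex ^ 'n"
  assumes "0 < p" "p \<le> (cmod (cinner_vec (B b) x))\<^sup>2"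
  shows "min_entropy B x \<le> - log 2 p"
proof -
  have "(cmod (cinner_vec (B b) x))\<^sup>2 \<le> Max (range (\<lambda>b. (cmod (cinner_vec (B b) x))\<^sup>2))"
    by (intro Max_ge) auto
  then have "p \<le> Max (range (\<lambda>b. (cmod (cinner_vec (B b) x))\<^sup>2))"
    using assms(2) by linarith
  then show ?thesis
    using assms(1) by (simp add: min_entropy_def)
qed

text \<open>Picking the likeliest outcome in each basis yields nearly orthogonal unit vectors. The
  Gram bound limits the sum of their probabilities, and concavity of the logarithm turns this into
  an entropy bound.\<close>

lemma sum_min_entropy_ge:
  fixes B :: "'i \<Rightarrow> 'n \<Rightarrow> complex ^ 'n"
  assumes J: "finite J" "J \<noteq> {}" and \<mu>: "0 \<le> \<mu>" and x: "norm x = 1"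
    and onb: "\<And>j. j \<in> J \<Longrightarrow> orthonormal_basis (B j)"
    and ov: "\<And>i j a b. i \<in> J \<Longrightarrow> j \<in> J \<Longrightarrow> i \<noteq> j \<Longrightarrow> cmod (cinner_vec (B i a) (B j b)) \<le> \<mu>"
  shows "(\<Sum>j\<in>J. min_entropy (B j) x)
    \<ge> - real (card J) * log 2 ((1 + real (card J - 1) * \<mu>) / real (card J))"
proof -
  define m where "m j = Max (range (\<lambda>b. (cmod (cinner_vec (B j b) x))\<^sup>2))" for j
  have "\<exists>b. m j = (cmod (cinner_vec (B j b) x))\<^sup>2" for j
  proof -
    have "m j \<in> range (\<lambda>b. (cmod (cinner_vec (B j b) x))\<^sup>2)"
      unfolding m_def by (intro Max_in) auto
    then show ?thesis by auto
  qed
  then obtain b where b: "\<And>j. m j = (cmod (cinner_vec (B j (b j)) x))\<^sup>2"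
    by metis
  have unit: "norm (B j (b j)) = 1" if "j \<in> J" for j
  proof -
    have "complex_of_real ((norm (B j (b j)))\<^sup>2) = of_real 1"
      using orthonormal_cinner[OF onb[OF that], of "b j" "b j"]
      by (simp only: cinner_vec_self) simp
    then show ?thesis
      by (simp only: of_real_eq_iff power2_eq_1_iff) (smt (verit) norm_ge_zero)
  qed
  have "(\<Sum>j\<in>J. m j) \<le> (1 + real (card J - 1) * \<mu>) * (norm x)\<^sup>2"
    unfolding b using J \<mu> unit ov by (intro sum_overlaps_le) auto
  then have le: "(\<Sum>j\<in>J. m j) \<le> real (card J) * ((1 + real (card J - 1) * \<mu>) / real (card J))"
    using J x by simp
  have "(\<Sum>j\<in>J. log 2 (m j)) \<le> real (card J) * log 2 ((1 + real (card J - 1) * \<mu>) / real (card J))"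
  proof (rule sum_log_le[OF _ _ _ le])
    show "0 < (1 + real (card J - 1) * \<mu>) / real (card J)"
      using J \<mu> by (intro divide_pos_pos add_pos_nonneg) (auto simp: card_gt_0_iff)
    show "0 < m j" if "j \<in> J" for j
      unfolding m_def using x onb[OF that] by (intro max_overlap_pos) auto
  qed simp
  then show ?thesis
    by (simp add: min_entropy_def m_def sum_negf)
qed

theorem mainTheorem4:
  fixes \<Gamma> :: "nat \<Rightarrow> complex ^ 4 ^ 4"
    and B :: "nat \<Rightarrow> 4 \<Rightarrow> complex ^ 4"
    and U :: "complex ^ 4 ^ 4"
  assumes "\<And>j. j < 4 \<Longrightarrow> hermitian_mat (\<Gamma> j)"
    and "\<And>j. j < 4 \<Longrightarrow> \<Gamma> j ** \<Gamma> j = mat 1"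
    and "\<And>j k. j < 4 \<Longrightarrow> k < 4 \<Longrightarrow> j \<noteq> k \<Longrightarrow> \<Gamma> j ** \<Gamma> k = - (\<Gamma> k ** \<Gamma> j)"
    and "\<Gamma> 4 = \<Gamma> 0 ** \<Gamma> 1 ** \<Gamma> 2 ** \<Gamma> 3"
    and "common_eigenbasis {\<Gamma> 0, \<i> \<cdot>\<^sub>m (\<Gamma> 1 ** \<Gamma> 4), \<i> \<cdot>\<^sub>m (\<Gamma> 2 ** \<Gamma> 3)} (B 0)"
    and "common_eigenbasis {\<Gamma> 1, \<i> \<cdot>\<^sub>m (\<Gamma> 2 ** \<Gamma> 4), \<i> \<cdot>\<^sub>m (\<Gamma> 3 ** \<Gamma> 0)} (B 1)"
    and "common_eigenbasis {\<Gamma> 2, \<i> \<cdot>\<^sub>m (\<Gamma> 3 ** \<Gamma> 4), \<i> \<cdot>\<^sub>m (\<Gamma> 0 ** \<Gamma> 1)} (B 2)"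
    and "common_eigenbasis {\<Gamma> 3, \<i> \<cdot>\<^sub>m (\<Gamma> 0 ** \<Gamma> 4), \<i> \<cdot>\<^sub>m (\<Gamma> 1 ** \<Gamma> 2)} (B 3)"
    and "unitary_mat U"
    and "\<And>j. j < 4 \<Longrightarrow> U ** \<Gamma> j ** adjoint_mat U = \<Gamma> ((j + 1) mod 4)"
  shows "(\<forall>\<psi>. norm \<psi> = 1 \<longrightarrow>
            1 / 4 * (\<Sum>j<4. min_entropy (B j) \<psi>) \<ge> - log 2 (1 / 4 * (1 + 3 / 2)))
       \<and> (\<exists>\<psi>. norm \<psi> = 1 \<and> eigenvector_of U \<psi> \<and>
            1 / 4 * (\<Sum>j<4. min_entropy (B j) \<psi>) = - log 2 (1 / 4 * (1 + 3 / 2)))"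
proof -
  note B = assms(5-8) and U = assms(10)
  interpret clifford4 \<Gamma>
    using assms(1-4) by unfold_locales
  have eb: "common_eigenbasis {T j 0, T j 1, T j 2} (B j)" if "j < 4" for j
    using less4_cases[OF that] B
    by (elim disjE) (simp_all add: T_table del: One_nat_def)
  \<comment> \<open>The conjugation relation multiplied by \<open>U\<close> on the right becomes an
    intertwining relation.\<close>
  have U': "U *v (\<Gamma> j *v x) = \<Gamma> ((j + 1) mod 4) *v (U *v x)" if "j < 4" for j x
    using assms(9) U[OF that, symmetric]
    by (simp add: unitary_mat_def matrix_vector_mul_assoc matrix_mul_assoc[symmetric])
  have ge: "1 / 4 * (\<Sum>j<4. min_entropy (B j) \<psi>) \<ge> - log 2 (1 / 4 * (1 + 3 / 2))"
    if "norm \<psi> = 1" for \<psi>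
    using sum_min_entropy_ge[of "{..<4::nat}" "1 / 2" \<psi> B] that eb
      mutually_unbiased[OF _ _ _ eb eb]
    by (simp add: common_eigenbasis_def lessThan_empty_iff mult.commute)
  obtain \<psi> \<beta> where \<psi>: "norm \<psi> = 1" "eigenvector_of U \<psi>"
    and ov: "\<And>j. j < 4 \<Longrightarrow> (cmod (cinner_vec (B j (\<beta> j)) \<psi>))\<^sup>2 = 5 / 8"
    using symmetric_state[OF eb U'] by metis
  \<comment> \<open>One outcome of probability 5/8 = (1 + 3/2)/4 in each basis bounds the entropy
    from above. Together with the general lower bound this forces equality, without identifying the
    maximal outcome.\<close>
  have "(\<Sum>j<4. min_entropy (B j) \<psi>) \<le> (\<Sum>j<4::nat. - log 2 (5 / 8))"
  proof (rule sum_mono)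
    fix j :: nat assume "j \<in> {..<4}"
    then show "min_entropy (B j) \<psi> \<le> - log 2 (5 / 8)"
      using ov[of j] by (intro min_entropy_le[of _ _ "\<beta> j"]) auto
  qed
  then have "1 / 4 * (\<Sum>j<4. min_entropy (B j) \<psi>) = - log 2 (1 / 4 * (1 + 3 / 2))"
    using ge[OF \<psi>(1)] by simp
  with ge \<psi> show ?thesis by blast
qed

end
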